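(* Let $(V,E)$ be a finite simple graph with Whitney complex $G$, let $R$ be a totally ordered set, and let $(\Omega,\mathcal{A},\mathrm{P})$ be a probability space of locally injective functions $g:V\to R$, such that for every $v\in V$ the index $g\mapsto i_g(v)$ is a random variable. If $K(v)=\mathrm{E}[i_g(v)]$ for $v\in V$, then $\sum_{v\in V}K(v)=\chi(G)$.
   Context: The Whitney complex of a finite simple graph is the set of all non-empty vertex sets of complete subgraphs. A simplex with $k+1$ vertices has $\omega(x)=(-1)^{k}$; the Euler characteristic $\chi$ of a graph or complex is the sum of $\omega(x)$ over all its simplices (empty graph: $0$). A function $g:V\to R$ is locally injective if $g(v)\neq g(w)$ whenever $(v,w)\in E$. The index is $i_g(v)=1-\chi(S_g^-(v))$, where $S_g^-(v)$ is the subgraph induced by the neighbors $w$ of $v$ with $g(w)<g(v)$. $\mathrm{E}$ denotes expectation with respect to $\mathrm{P}$. *)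

theory Defs
  imports
    "HOL-Probability.Probability_Measure"
    "HOL-Library.FuncSet"
    "Graph_Theory.Kuratowski"
begin

text \<open>
  A finite simple graph $(V,E)$ is a digraph \<open>\<Gamma>\<close> satisfying the locale predicate
  \<^locale>\<open>graph\<close>: finite, without loops or parallel arcs, and symmetric, so that each undirected
  edge is a pair of opposite arcs. Here $V$ is \<open>verts \<Gamma>\<close>, and $(v,w) \in E$ is
  \<open>v \<rightarrow>\<^bsub>\<Gamma>\<^esub> w\<close>, that is \<open>(v,w) \<in> arcs_ends \<Gamma>\<close>. The empty graph is allowed.
\<close>

definition whitney_complex :: "('a,'b) pre_digraph \<Rightarrow> 'a set set" where
  "whitney_complex \<Gamma> =
     {verts H | H. subgraph H \<Gamma> \<and> complete_digraph (card (verts H)) H \<and> verts H \<noteq> {}}"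

text \<open>The truncated subtraction is harmless: simplices are non-empty.\<close>

definition simplex_sign :: "'a set \<Rightarrow> int" where
  "simplex_sign x = (-1) ^ (card x - 1)"

definition euler_char :: "'a set set \<Rightarrow> int" where
  "euler_char C = (\<Sum>x\<in>C. simplex_sign x)"

definition graph_euler_char :: "('a,'b) pre_digraph \<Rightarrow> int" where
  "graph_euler_char \<Gamma> = euler_char (whitney_complex \<Gamma>)"

definition locally_injective :: "('a,'b) pre_digraph \<Rightarrow> ('a \<Rightarrow> 'r) \<Rightarrow> bool" where
  "locally_injective \<Gamma> g \<longleftrightarrow> (\<forall>v w. v \<rightarrow>\<^bsub>\<Gamma>\<^esub> w \<longrightarrow> g v \<noteq> g w)"

definition lower_sphere ::
  "('a,'b) pre_digraph \<Rightarrow> ('a \<Rightarrow> 'r::linorder) \<Rightarrow> 'a \<Rightarrow> ('a,'b) pre_digraph" where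
  "lower_sphere \<Gamma> g v = \<Gamma> \<restriction> {w. v \<rightarrow>\<^bsub>\<Gamma>\<^esub> w \<and> g w < g v}"

definition index :: "('a,'b) pre_digraph \<Rightarrow> ('a \<Rightarrow> 'r::linorder) \<Rightarrow> 'a \<Rightarrow> int" where
  "index \<Gamma> g v = 1 - graph_euler_char (lower_sphere \<Gamma> g v)"

end

theory Submission
  imports Defs
begin

text \<open>
  For a locally injective \<open>g\<close>, every simplex has a unique vertex maximizing \<open>g\<close>. The simplices
  with maximizing vertex \<open>v\<close> are \<open>{v}\<close>, of sign \<open>1\<close>, and the cones \<open>insert v y\<close> over the simplices
  \<open>y\<close> of \<open>S\<^sub>g\<^sup>-(v)\<close>, of sign opposite to that of \<open>y\<close>. So their signs add up to the index of \<open>g\<close>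
  at \<open>v\<close>, and the indices of \<open>g\<close> sum to the Euler characteristic; integrate over \<open>g\<close>.
\<close>

lemma arcs_ends_induce_subgraph: "arcs_ends (G \<restriction> S) = arcs_ends G \<inter> S \<times> S"
  unfolding arcs_ends_conv by auto

lemma (in graph) graph_induce_subgraph:
  assumes "S \<subseteq> verts G"
  shows "graph (G \<restriction> S)"
proof -
  interpret S: sym_digraph "G \<restriction> S"
    using assms by (intro induced_graph_imp_graph induced_induce)
  have "finite S" using assms by (rule finite_subset) simp
  then show ?thesis
    by unfold_locales (auto simp: no_loops intro: no_multi_arcs)
qed

text \<open>Adjacency in a subgraph is adjacency in \<open>G\<close>. Conversely, a set of pairwise
  adjacent vertices is realised by the induced subgraph \<open>G \<restriction> x\<close>, whose
  ends are exactly the off-diagonal pairs because \<open>G\<close> has no loops. This form removes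
  the quantifier over subgraphs.\<close>

lemma (in graph) whitney_complex_conv:
  "whitney_complex G =
     {x. x \<subseteq> verts G \<and> x \<noteq> {} \<and> (\<forall>u\<in>x. \<forall>v\<in>x. u \<noteq> v \<longrightarrow> u \<rightarrow>\<^bsub>G\<^esub> v)}"
proof (intro set_eqI iffI)
  fix x assume "x \<in> whitney_complex G"
  then obtain H where H: "x = verts H" "subgraph H G" "complete_digraph (card (verts H)) H"
    "verts H \<noteq> {}"
    unfolding whitney_complex_def by auto
  then show "x \<in> {x. x \<subseteq> verts G \<and> x \<noteq> {} \<and> (\<forall>u\<in>x. \<forall>v\<in>x. u \<noteq> v \<longrightarrow> u \<rightarrow>\<^bsub>G\<^esub> v)}"
    using arcs_ends_mono[OF H(2)] subgraph_imp_subverts[OF H(2)]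
    by (auto simp: complete_digraph_def)
next
  fix x assume x: "x \<in> {x. x \<subseteq> verts G \<and> x \<noteq> {} \<and> (\<forall>u\<in>x. \<forall>v\<in>x. u \<noteq> v \<longrightarrow> u \<rightarrow>\<^bsub>G\<^esub> v)}"
  let ?H = "G \<restriction> x"
  have sub: "subgraph ?H G"
    using x by (intro induced_imp_subgraph induced_induce) auto
  have "graph ?H"
    using x by (intro graph_induce_subgraph) auto
  moreover have "arcs_ends ?H = {(u,v). (u,v) \<in> x \<times> x \<and> u \<noteq> v}"
    unfolding arcs_ends_induce_subgraph using x by (auto dest: adj_not_same)
  ultimately show "x \<in> whitney_complex G"
    using sub x unfolding whitney_complex_def complete_digraph_def
    by (intro CollectI exI[of _ ?H]) simp
qed

text \<open>Inducing keeps all adjacencies inside \<open>S\<close>, so cliques within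
  \<open>S\<close> are unchanged. This lets simplices of a lower sphere be handled as simplices of
  \<open>G\<close>.\<close>

lemma (in graph) whitney_complex_induce_subgraph:
  assumes "S \<subseteq> verts G"
  shows "whitney_complex (G \<restriction> S) = {x \<in> whitney_complex G. x \<subseteq> S}"
proof -
  interpret S: graph "G \<restriction> S"
    using assms by (rule graph_induce_subgraph)
  have "u \<rightarrow>\<^bsub>G \<restriction> S\<^esub> v \<longleftrightarrow> u \<in> S \<and> v \<in> S \<and> u \<rightarrow>\<^bsub>G\<^esub> v" for u v
    unfolding arcs_ends_induce_subgraph by auto
  then show ?thesis
    unfolding S.whitney_complex_conv whitney_complex_conv using assms by auto
qed

lemma (in graph) finite_whitney_complex: "finite (whitney_complex G)"
  by (rule finite_subset[of _ "Pow (verts G)"]) (auto simp: whitney_complex_conv)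

lemma (in graph) finite_simplex: "x \<in> whitney_complex G \<Longrightarrow> finite x"
  by (auto simp: whitney_complex_conv intro: finite_subset[OF _ finite_verts])

text \<open>Strictness makes these sets disjoint for distinct \<open>v\<close>; local injectivity
  makes them cover the complex.\<close>

definition simplices_with_max ::
  "('a,'b) pre_digraph \<Rightarrow> ('a \<Rightarrow> 'r::linorder) \<Rightarrow> 'a \<Rightarrow> 'a set set" where
  "simplices_with_max \<Gamma> g v = {x \<in> whitney_complex \<Gamma>. v \<in> x \<and> (\<forall>w\<in>x. w \<noteq> v \<longrightarrow> g w < g v)}"

text \<open>Removing \<open>v\<close> leaves a clique of lower neighbors or the empty set, and
  adding \<open>v\<close> back reverses this. The extra \<open>{}\<close> accounts for the simplex
  \<open>{v}\<close>, since \<open>{}\<close> is not itself a simplex.\<close>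

lemma (in graph) simplices_with_max_conv_cones:
  fixes g :: "'a \<Rightarrow> 'r::linorder"
  assumes v: "v \<in> verts G"
  shows "simplices_with_max G g v = insert v ` insert {} (whitney_complex (lower_sphere G g v))"
    (is "?L = insert v ` insert {} ?W")
proof -
  let ?S = "{w. v \<rightarrow>\<^bsub>G\<^esub> w \<and> g w < g v}"
  have W: "?W = {x \<in> whitney_complex G. x \<subseteq> ?S}"
    unfolding lower_sphere_def
    by (rule whitney_complex_induce_subgraph) (auto dest: adj_in_verts)
  show ?thesis
  proof (intro equalityI subsetI)
    fix x assume x: "x \<in> ?L"
    then have "x - {v} \<in> insert {} ?W"
      unfolding W by (auto simp: simplices_with_max_def whitney_complex_conv)
    moreover have "x = insert v (x - {v})"
      using x by (auto simp: simplices_with_max_def)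
    ultimately show "x \<in> insert v ` insert {} ?W" by blast
  next
    fix x assume "x \<in> insert v ` insert {} ?W"
    then obtain y where "y \<in> insert {} ?W" "x = insert v y" by blast
    then show "x \<in> ?L"
      unfolding W using v
      by (auto simp: simplices_with_max_def whitney_complex_conv dest: graph_symmetric)
  qed
qed

lemma (in graph) sum_simplices_with_max:
  fixes g :: "'a \<Rightarrow> 'r::linorder"
  assumes v: "v \<in> verts G"
  shows "(\<Sum>x\<in>simplices_with_max G g v. simplex_sign x) = index G g v"
proof -
  let ?S = "{w. v \<rightarrow>\<^bsub>G\<^esub> w \<and> g w < g v}"
  let ?W = "whitney_complex (lower_sphere G g v)"
  have W: "?W = {x \<in> whitney_complex G. x \<subseteq> ?S}"
    unfolding lower_sphere_def
    by (rule whitney_complex_induce_subgraph) (auto dest: adj_in_verts)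
  have notin: "v \<notin> y" if "y \<in> insert {} ?W" for y
    using that unfolding W by auto
  have ne: "{} \<notin> ?W" unfolding W whitney_complex_conv by simp
  have fin: "finite ?W" unfolding W using finite_whitney_complex by simp
  \<comment> \<open>Restricted to non-empty \<open>y\<close>: truncated subtraction gives
    \<open>{}\<close> and \<open>{v}\<close> the same sign 1, so the sign would not flip
    there.\<close>
  have sign: "simplex_sign (insert v y) = - simplex_sign y" if "y \<in> ?W" for y
  proof -
    have "finite y" "y \<noteq> {}"
      using that finite_simplex ne unfolding W by auto
    then obtain k where "card y = Suc k"
      by (metis card_eq_0_iff not0_implies_Suc)
    with \<open>finite y\<close> notin[of y] that show ?thesis
      by (simp add: simplex_sign_def)
  qed
  have "inj_on (insert v) (insert {} ?W)"
    using notin by (intro inj_onI) (metis insert_ident)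
  then have "(\<Sum>x\<in>simplices_with_max G g v. simplex_sign x) =
      (\<Sum>y\<in>insert {} ?W. simplex_sign (insert v y))"
    unfolding simplices_with_max_conv_cones[OF v] by (subst sum.reindex) (simp_all only: o_def)
  \<comment> \<open>The 1 is the sign of \<open>{v}\<close>, the cone over
    \<open>{}\<close>.\<close>
  also have "\<dots> = 1 + (\<Sum>y\<in>?W. - simplex_sign y)"
    using ne fin sign by (simp add: simplex_sign_def)
  also have "\<dots> = index G g v"
    by (simp add: index_def graph_euler_char_def euler_char_def sum_negf)
  finally show ?thesis .
qed

theorem (in graph) poincare_hopf:
  fixes g :: "'a \<Rightarrow> 'r::linorder"
  assumes g: "locally_injective G g"
  shows "(\<Sum>v\<in>verts G. index G g v) = euler_char (whitney_complex G)"
proof -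
  have "\<exists>v\<in>verts G. x \<in> simplices_with_max G g v" if x: "x \<in> whitney_complex G" for x
  proof -
    have "finite (g ` x)" "g ` x \<noteq> {}"
      using x finite_simplex by (auto simp: whitney_complex_conv)
    then have "Max (g ` x) \<in> g ` x" "\<forall>w\<in>x. g w \<le> Max (g ` x)"
      by auto
    then obtain v where v: "v \<in> x" "\<forall>w\<in>x. g w \<le> g v"
      by auto
    \<comment> \<open>Distinct vertices of a simplex are adjacent, so local injectivity makes the
      maximum strict.\<close>
    moreover have "g w \<noteq> g v" if "w \<in> x" "w \<noteq> v" for w
      using that v(1) x g unfolding whitney_complex_conv locally_injective_def by auto
    ultimately show ?thesis
      using x by (auto simp: simplices_with_max_def order.strict_iff_order whitney_complex_conv)
  qed
  then have un: "whitney_complex G = (\<Union>v\<in>verts G. simplices_with_max G g v)"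
    by (auto simp: simplices_with_max_def)
  have "euler_char (whitney_complex G) =
      (\<Sum>v\<in>verts G. \<Sum>x\<in>simplices_with_max G g v. simplex_sign x)"
    unfolding euler_char_def un
  proof (rule sum.UNION_disjoint)
    show "\<forall>v\<in>verts G. finite (simplices_with_max G g v)"
      using finite_whitney_complex by (auto simp: simplices_with_max_def)
    \<comment> \<open>A common simplex would contain both vertices and give \<open>g w < g v\<close>
      and \<open>g v < g w\<close>.\<close>
    show "\<forall>v\<in>verts G. \<forall>w\<in>verts G. v \<noteq> w \<longrightarrow>
        simplices_with_max G g v \<inter> simplices_with_max G g w = {}"
      unfolding simplices_with_max_def by (force dest: order.asym)
  qed simp
  also have "\<dots> = (\<Sum>v\<in>verts G. index G g v)"
    by (simp add: sum_simplices_with_max)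
  finally show ?thesis ..
qed

text \<open>The index depends on \<open>g\<close> only through the vertex set of the lower sphere,
  one of finitely many subsets of \<open>verts G\<close>. The resulting bound yields
  integrability.\<close>

lemma (in graph) finite_range_index: "finite (range (\<lambda>g :: 'a \<Rightarrow> 'r::linorder. index G g v))"
proof (rule finite_subset)
  show "range (\<lambda>g :: 'a \<Rightarrow> 'r. index G g v) \<subseteq>
      (\<lambda>S. 1 - graph_euler_char (G \<restriction> S)) ` Pow (verts G)"
    unfolding index_def lower_sphere_def by (auto dest: adj_in_verts)
qed simp

theorem mainTheorem3:
  fixes \<Gamma> :: "('a,'b) pre_digraph"
    and R :: "'r::linorder set"
    and M :: "('a \<Rightarrow> 'r) measure"
    and K :: "'a \<Rightarrow> real"
  assumes "graph \<Gamma>"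
    and "prob_space M"
    and "space M \<subseteq> {g \<in> verts \<Gamma> \<rightarrow>\<^sub>E R. locally_injective \<Gamma> g}"
    and "\<And>v. v \<in> verts \<Gamma> \<Longrightarrow>
           prob_space.random_variable M borel (\<lambda>g. real_of_int (index \<Gamma> g v))"
    and "\<And>v. v \<in> verts \<Gamma> \<Longrightarrow>
           K v = prob_space.expectation M (\<lambda>g. real_of_int (index \<Gamma> g v))"
  shows "(\<Sum>v\<in>verts \<Gamma>. K v) = real_of_int (euler_char (whitney_complex \<Gamma>))"
proof -
  interpret \<Gamma>: graph \<Gamma> by fact
  interpret M: prob_space M by fact
  have int: "integrable M (\<lambda>g. real_of_int (index \<Gamma> g v))" if v: "v \<in> verts \<Gamma>" for v
  proof -
    \<comment> \<open>One bound \<open>B\<close> serves all \<open>g\<close>, so measurability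
      suffices for integrability on a probability space; the sum and the expectation can then be
      exchanged.\<close>
    obtain B where "\<And>g :: 'a \<Rightarrow> 'r. \<bar>real_of_int (index \<Gamma> g v)\<bar> \<le> B"
      using finite_imp_bounded[OF finite_imageI[OF \<Gamma>.finite_range_index], of real_of_int v]
      by (auto simp: bounded_iff)
    then show ?thesis
      using assms(4)[OF v] by (intro M.integrable_const_bound[of _ B]) auto
  qed
  have "(\<Sum>v\<in>verts \<Gamma>. K v) = (\<Sum>v\<in>verts \<Gamma>. M.expectation (\<lambda>g. real_of_int (index \<Gamma> g v)))"
    using assms(5) by simp
  also have "\<dots> = M.expectation (\<lambda>g. \<Sum>v\<in>verts \<Gamma>. real_of_int (index \<Gamma> g v))"
    using int by (simp add: Bochner_Integration.integral_sum)
  \<comment> \<open>The integrands agree pointwise on \<open>space M\<close>, where every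
    \<open>g\<close> is locally injective; the new one is constant in \<open>g\<close>.\<close>
  also have "\<dots> = M.expectation (\<lambda>g. real_of_int (euler_char (whitney_complex \<Gamma>)))"
  proof (rule Bochner_Integration.integral_cong)
    fix g assume "g \<in> space M"
    then have "locally_injective \<Gamma> g" using assms(3) by auto
    then show "(\<Sum>v\<in>verts \<Gamma>. real_of_int (index \<Gamma> g v)) =
        real_of_int (euler_char (whitney_complex \<Gamma>))"
      by (simp flip: of_int_sum \<Gamma>.poincare_hopf)
  qed simp
  also have "\<dots> = real_of_int (euler_char (whitney_complex \<Gamma>))"
    by (simp add: M.prob_space)
  finally show ?thesis .
qed

end
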